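(* Let $d = \dim \mathcal{S}$ and fix an integer $1 \leq k < d$. Let $\mathcal{E}_k \subset \mathcal{S}$ be a maximal $\nabla$-autoparallel submanifold of dimension $k$, and let $P_0 \in \mathcal{E}_k$. Then there exists a unique maximal $\nabla^*$-autoparallel submanifold $\mathcal{M}_k \subset \mathcal{S}$ of dimension $d-k$ such that $\mathcal{E}_k \cap \mathcal{M}_k = \{P_0\}$ and the two submanifolds meet orthogonally at $P_0$, i.e., $\langle u, v \rangle = 0$ for all $u \in T_{P_0}\mathcal{E}_k$ and $v \in T_{P_0}\mathcal{M}_k$.
   Context: Setting. Let $\alpha > 0$, let $\Theta \subset \mathbb{R}^d$ be a nonempty open convex set, and let $\varphi : \Theta \to \mathbb{R}$ be a smooth $\alpha$-exponentially concave function, i.e. $\Phi = e^{\alpha\varphi}$ is concave; assume moreover that the Hessian $\mathsf{D}^2\Phi$ is strictly negative definite at every point of $\Theta$ and that $1 - \alpha\, \mathsf{D}\varphi(\theta)\cdot\theta > 0$ for all $\theta \in \Theta$. Here $\mathsf{D}$ is the Euclidean gradient and $\cdot$ the Euclidean dot product. The $L^{(\alpha)}$-divergence of $\varphi$ is $$\mathbf{L}_\varphi^{(\alpha)}[\theta:\theta'] = \frac{1}{\alpha}\log\bigl(1 + \alpha\, \mathsf{D}\varphi(\theta')\cdot(\theta-\theta')\bigr) - (\varphi(\theta)-\varphi(\theta')), \quad \theta,\theta' \in \Theta.$$ The manifold $\mathcal{S}$ is the $d$-dimensional manifold with global (primal) coordinate system $P \mapsto \theta_P \in \Theta$ (a bijection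 onto $\Theta$). The dual coordinate system is $$\eta_P = \mathsf{T}(\theta_P) := \frac{\mathsf{D}\varphi(\theta_P)}{1-\alpha\,\mathsf{D}\varphi(\theta_P)\cdot\theta_P},$$ where $\mathsf{T}$ is a diffeomorphism of $\Theta$ onto its (open) range $\Omega \subset \mathbb{R}^d$. Define the divergence on $\mathcal{S}$ by $\mathbf{D}[P:Q] := \mathbf{L}_\varphi^{(\alpha)}[\theta_P:\theta_Q]$. Riemannian metric. $\langle\cdot,\cdot\rangle = g$ is the Riemannian metric on $\mathcal{S}$ induced by $\mathbf{D}$ in the sense of Eguchi: in primal coordinates, $$g_{ij}(\theta) = \left\langle \frac{\partial}{\partial\theta_i},\frac{\partial}{\partial\theta_j}\right\rangle = -\left.\frac{\partial^2}{\partial\theta_i\,\partial\theta'_j}\mathbf{L}_\varphi^{(\alpha)}[\theta:\theta']\right|_{\theta'=\theta}.$$ Autoparallel submanifolds. A maximal $\nabla$-autoparallel submanifold of dimension $k$ is a nonempty set of the form $\{P \in \mathcal{S} : \theta_P - \theta_{P_0} \in A_0\}$, where $P_0 \in \mathcal{S}$ and $A_0 \subset \mathbb{R}^d$ is a $k$-dimensional vector subspace. A maximal $\nabla^*$-autoparallel submanifold of dimension $d-k$ is a nonempty set of the form $\{P \in \mathcal{S} : \eta_P - \eta_{P_0} \in B_0\}$, where $P_0 \in \mathcal{S}$ and $B_0 \subset \mathbb{R}^d$ is a $(d-k)$-dimensional vector subspace. *)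

theory Defs
  imports "HOL-Analysis.Analysis"
begin

(* For open S only: then differentiability at x in S does not depend on values outside S. *)

primrec C_times_on :: "nat \<Rightarrow> 'a::euclidean_space set \<Rightarrow> ('a \<Rightarrow> 'b::real_normed_vector) \<Rightarrow> bool" where
  "C_times_on 0 S f \<longleftrightarrow> continuous_on S f"
| "C_times_on (Suc m) S f \<longleftrightarrow>
     (\<forall>x\<in>S. f differentiable (at x)) \<and>
     (\<forall>b\<in>Basis. C_times_on m S (\<lambda>x. frechet_derivative f (at x) b))"

definition smooth_on :: "'a::euclidean_space set \<Rightarrow> ('a \<Rightarrow> 'b::real_normed_vector) \<Rightarrow> bool" where
  "smooth_on S f \<longleftrightarrow> (\<forall>m. C_times_on m S f)"

definition grad :: "(real^'n \<Rightarrow> real) \<Rightarrow> real^'n \<Rightarrow> real^'n" where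
  "grad f x = (THE D. GDERIV f x :> D)"

definition hessian :: "(real^'n \<Rightarrow> real) \<Rightarrow> real^'n \<Rightarrow> real^'n^'n" where
  "hessian f x = jacobian (grad f) (at x)"

definition negative_definite :: "real^'n^'n \<Rightarrow> bool" where
  "negative_definite H \<longleftrightarrow> (\<forall>v. v \<noteq> 0 \<longrightarrow> v \<bullet> (H *v v) < 0)"

definition L_divergence ::
    "real \<Rightarrow> (real^'n \<Rightarrow> real) \<Rightarrow> real^'n \<Rightarrow> real^'n \<Rightarrow> real" where
  "L_divergence \<alpha> \<phi> \<theta> \<theta>' =
     (1 / \<alpha>) * ln (1 + \<alpha> * (grad \<phi> \<theta>' \<bullet> (\<theta> - \<theta>'))) - (\<phi> \<theta> - \<phi> \<theta>')"

definition dual_map :: "real \<Rightarrow> (real^'n \<Rightarrow> real) \<Rightarrow> real^'n \<Rightarrow> real^'n" where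
  "dual_map \<alpha> \<phi> \<theta> = (1 / (1 - \<alpha> * (grad \<phi> \<theta> \<bullet> \<theta>))) *\<^sub>R grad \<phi> \<theta>"

definition partial :: "'n \<Rightarrow> (real^'n \<Rightarrow> real) \<Rightarrow> real^'n \<Rightarrow> real" where
  "partial i f x = deriv (\<lambda>t. f (x + t *\<^sub>R axis i 1)) 0"

definition eguchi_metric :: "(real^'n \<Rightarrow> real^'n \<Rightarrow> real) \<Rightarrow> real^'n \<Rightarrow> real^'n^'n" where
  "eguchi_metric D \<theta> = (\<chi> i j. - partial i (\<lambda>x. partial j (\<lambda>y. D x y) \<theta>) \<theta>)"

(* The manifold is a set S of points with a global chart c onto an open set. Tangent vectors
   at P are represented by their components in the coordinate frame of c. *)

definition inner_at :: "('p \<Rightarrow> real^'n) \<Rightarrow> (real^'n \<Rightarrow> real^'n \<Rightarrow> real) \<Rightarrow>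
    'p \<Rightarrow> real^'n \<Rightarrow> real^'n \<Rightarrow> real" where
  "inner_at c D P u v = (\<Sum>i\<in>UNIV. \<Sum>j\<in>UNIV. eguchi_metric D (c P) $ i $ j * u $ i * v $ j)"

definition tangent_space :: "('p \<Rightarrow> real^'n) \<Rightarrow> 'p set \<Rightarrow> 'p \<Rightarrow> (real^'n) set" where
  "tangent_space c N P = {v. \<exists>\<gamma> \<epsilon>. \<epsilon> > 0 \<and> \<gamma> ` {-\<epsilon><..<\<epsilon>} \<subseteq> N \<and> \<gamma> 0 = P \<and>
     smooth_on {-\<epsilon><..<\<epsilon>} (c \<circ> \<gamma>) \<and> ((c \<circ> \<gamma>) has_vector_derivative v) (at (0::real))}"

(* Autoparallel for the primal connection if c is the primal coordinate system \<theta>, and for the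
   dual connection if c is the dual one \<eta>: geodesics are straight in c up to reparametrisation. *)

definition maximal_autoparallel :: "'p set \<Rightarrow> ('p \<Rightarrow> real^'n) \<Rightarrow> nat \<Rightarrow> 'p set \<Rightarrow> bool" where
  "maximal_autoparallel S c k N \<longleftrightarrow>
     (\<exists>P\<^sub>0\<in>S. \<exists>A. subspace A \<and> dim A = k \<and> N = {P\<in>S. c P - c P\<^sub>0 \<in> A})"

end

theory Submission
  imports Defs
begin

text \<open>
  Put \<open>\<Phi> = exp (\<alpha> * \<phi>)\<close>, \<open>Q = D\<^sup>2\<phi> + \<alpha> D\<phi> (D\<phi>)\<^sup>T = D\<^sup>2\<Phi> / (\<alpha> \<Phi>)\<close> and \<open>J = I + \<alpha> \<eta> \<theta>\<^sup>T\<close>. The Eguchi metric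
  is \<open>- Q\<close>, and the Jacobian of the dual map is \<open>(1 + \<alpha> \<eta> \<bullet> \<theta>) J Q\<close>. So the dual submanifold through \<open>P\<^sub>0\<close>
  with direction space \<open>B\<close> is orthogonal to the primal one with direction space \<open>A\<close> iff \<open>B\<close> is the image
  under \<open>J\<close> (at \<open>P\<^sub>0\<close>) of the orthogonal complement of \<open>A\<close>. For this \<open>B\<close>, a second common point with
  coordinates \<open>\<theta>\<close> would satisfy
  \<open>(1 + \<alpha> D\<phi>(\<theta>\<^sub>0) \<bullet> (\<theta> - \<theta>\<^sub>0)) (1 + \<alpha> D\<phi>(\<theta>) \<bullet> (\<theta>\<^sub>0 - \<theta>)) = 1\<close>, whereas strict concavity of \<open>\<Phi>\<close> makes
  the left-hand side larger than \<open>1\<close>. The same computation shows that the dual map is injective.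
  Uniqueness needs enough smooth curves in the dual submanifold: the preimage \<open>\<gamma>\<close> of a line under the
  dual map solves \<open>\<gamma>' = F \<circ> \<gamma>\<close> with \<open>F\<close> smooth (by Cramer's rule), so it is smooth.
\<close>

subsection \<open>Functions of class \<open>C\<^sup>m\<close>\<close>

text \<open>On an open set the derivative at a point depends only on nearby values, so agreement on
  \<open>S\<close> is inherited by the derivatives of every order.\<close>

lemma C_times_on_cong:
  assumes "open S" "C_times_on m S f" "\<And>x. x \<in> S \<Longrightarrow> f x = g x"
  shows "C_times_on m S g"
  using assms(2,3)
proof (induction m arbitrary: f g)
  case 0
  then show ?case by (auto cong: continuous_on_cong)
next
  case (Suc m)
  have d: "(g has_derivative frechet_derivative f (at x)) (at x)" if "x \<in> S" for x
    by (rule has_derivative_transform_within_open[of f _ x UNIV S])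
      (use Suc.prems that \<open>open S\<close> in \<open>auto simp: frechet_derivative_works\<close>)
  have "C_times_on m S (\<lambda>x. frechet_derivative g (at x) b)" if "b \<in> Basis" for b
  proof (rule Suc.IH)
    show "C_times_on m S (\<lambda>x. frechet_derivative f (at x) b)" using Suc.prems(1) that by simp
    show "frechet_derivative f (at x) b = frechet_derivative g (at x) b" if "x \<in> S" for x
      by (rule fun_cong[OF frechet_derivative_at[OF d[OF that]]])
  qed
  moreover have "\<forall>x\<in>S. g differentiable (at x)" using differentiableI[OF d] by blast
  ultimately show ?case by simp
qed

lemma smooth_on_cong:
  assumes "open S" "smooth_on S f" "\<And>x. x \<in> S \<Longrightarrow> f x = g x"
  shows "smooth_on S g"
  unfolding smooth_on_def
proof
  fix m show "C_times_on m S g"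
    using assms(1) assms(2)[unfolded smooth_on_def, rule_format] assms(3) by (rule C_times_on_cong)
qed

text \<open>Lets the closure proofs below exhibit any explicit derivative \<open>f'\<close> in place
  of \<open>frechet_derivative\<close>.\<close>

lemma C_times_on_Suc_iff:
  assumes "open S"
  shows "C_times_on (Suc m) S f \<longleftrightarrow> (\<exists>f'. (\<forall>x\<in>S. (f has_derivative f' x) (at x)) \<and>
     (\<forall>b\<in>Basis. C_times_on m S (\<lambda>x. f' x b)))" (is "?L \<longleftrightarrow> ?R")
proof
  assume ?L
  then show ?R
    by (intro exI[of _ "\<lambda>x. frechet_derivative f (at x)"]) (auto simp: frechet_derivative_works)
next
  assume ?R
  then obtain f' where f': "\<And>x. x \<in> S \<Longrightarrow> (f has_derivative f' x) (at x)"
    and C: "\<And>b. b\<in>Basis \<Longrightarrow> C_times_on m S (\<lambda>x. f' x b)" by blast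
  have "C_times_on m S (\<lambda>x. frechet_derivative f (at x) b)" if "b \<in> Basis" for b
    using C[OF that] by (rule C_times_on_cong[OF assms]) (simp add: frechet_derivative_at[OF f', symmetric])
  with f' show ?L by (auto simp: differentiable_def)
qed

lemma C_times_on_Suc_imp: "C_times_on (Suc m) S f \<Longrightarrow> C_times_on m S f"
proof (induction m arbitrary: f)
  case 0
  then show ?case
    by (auto intro!: continuous_at_imp_continuous_on differentiable_imp_continuous_within)
next
  case (Suc m)
  then show ?case using C_times_on.simps(2) by blast
qed

lemma C_times_on_const: "C_times_on m S (\<lambda>x. c)"
  by (induction m arbitrary: c) (auto simp: frechet_derivative_const)

lemma C_times_on_ident:
  assumes "open S"
  shows "C_times_on m S (\<lambda>x. x)"
proof (cases m)
  case (Suc m')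
  show ?thesis unfolding Suc C_times_on_Suc_iff[OF assms]
    by (intro exI[of _ "\<lambda>x b. b"]) (auto intro: C_times_on_const)
qed (simp add: continuous_on_id)

lemma C_times_on_linear:
  assumes "open S" "bounded_linear h"
  shows "C_times_on m S f \<Longrightarrow> C_times_on m S (\<lambda>x. h (f x))"
proof (induction m arbitrary: f)
  case 0
  then show ?case by (auto intro: bounded_linear.continuous_on[OF assms(2)])
next
  case (Suc m)
  then obtain f' where "\<forall>x\<in>S. (f has_derivative f' x) (at x)"
    "\<forall>b\<in>Basis. C_times_on m S (\<lambda>x. f' x b)"
    unfolding C_times_on_Suc_iff[OF assms(1)] by blast
  then show ?case unfolding C_times_on_Suc_iff[OF assms(1)]
    by (intro exI[of _ "\<lambda>x b. h (f' x b)"])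
      (auto intro: Suc.IH bounded_linear.has_derivative[OF assms(2)])
qed

lemma C_times_on_add:
  assumes "open S"
  shows "C_times_on m S f \<Longrightarrow> C_times_on m S g \<Longrightarrow> C_times_on m S (\<lambda>x. f x + g x)"
proof (induction m arbitrary: f g)
  case 0
  then show ?case by (auto intro: continuous_intros)
next
  case (Suc m)
  obtain f' where "\<forall>x\<in>S. (f has_derivative f' x) (at x)"
    "\<forall>b\<in>Basis. C_times_on m S (\<lambda>x. f' x b)"
    using Suc.prems(1) unfolding C_times_on_Suc_iff[OF assms] by blast
  moreover obtain g' where "\<forall>x\<in>S. (g has_derivative g' x) (at x)"
    "\<forall>b\<in>Basis. C_times_on m S (\<lambda>x. g' x b)"
    using Suc.prems(2) unfolding C_times_on_Suc_iff[OF assms] by blast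
  ultimately show ?case unfolding C_times_on_Suc_iff[OF assms]
    by (intro exI[of _ "\<lambda>x b. f' x b + g' x b"]) (auto intro: Suc.IH has_derivative_add)
qed

lemma C_times_on_sum:
  assumes "open S" "\<And>i. i \<in> I \<Longrightarrow> C_times_on m S (f i)"
  shows "C_times_on m S (\<lambda>x. \<Sum>i\<in>I. f i x)"
  using assms(2)
  by (induction I rule: infinite_finite_induct)
    (auto intro: C_times_on_const C_times_on_add[OF assms(1)])

text \<open>Product rule: each summand of the derivative pairs one differentiated factor with an
  undifferentiated one, and the latter is lowered from order \<open>Suc m\<close> to order
  \<open>m\<close>. The instances used are products, scalar multiples and inner products.\<close>

lemma C_times_on_bilinear:
  assumes "open S" "bounded_bilinear h"
  shows "C_times_on m S f \<Longrightarrow> C_times_on m S g \<Longrightarrow> C_times_on m S (\<lambda>x. h (f x) (g x))"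
proof (induction m arbitrary: f g)
  case 0
  then show ?case by (auto intro: bounded_bilinear.continuous_on[OF assms(2)])
next
  case (Suc m)
  obtain f' where "\<forall>x\<in>S. (f has_derivative f' x) (at x)"
    "\<forall>b\<in>Basis. C_times_on m S (\<lambda>x. f' x b)"
    using Suc.prems(1) unfolding C_times_on_Suc_iff[OF assms(1)] by blast
  moreover obtain g' where "\<forall>x\<in>S. (g has_derivative g' x) (at x)"
    "\<forall>b\<in>Basis. C_times_on m S (\<lambda>x. g' x b)"
    using Suc.prems(2) unfolding C_times_on_Suc_iff[OF assms(1)] by blast
  ultimately show ?case unfolding C_times_on_Suc_iff[OF assms(1)]
    using Suc.prems[THEN C_times_on_Suc_imp]
    by (intro exI[of _ "\<lambda>x b. h (f x) (g' x b) + h (f' x b) (g x)"])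
      (auto intro!: C_times_on_add[OF assms(1)] Suc.IH bounded_bilinear.FDERIV[OF assms(2)])
qed

lemma C_times_on_prod:
  fixes f :: "'i \<Rightarrow> 'a::euclidean_space \<Rightarrow> real"
  assumes "open S" "\<And>i. i \<in> I \<Longrightarrow> C_times_on m S (f i)"
  shows "C_times_on m S (\<lambda>x. \<Prod>i\<in>I. f i x)"
  using assms(2)
  by (induction I rule: infinite_finite_induct)
    (auto intro: C_times_on_const C_times_on_bilinear[OF assms(1) bounded_bilinear_mult])

text \<open>The derivative of \<open>inverse (f x)\<close> contains only
  \<open>inverse (f x)\<close> and \<open>f'\<close>, so the induction hypothesis and the product
  rule suffice.\<close>

lemma C_times_on_inverse:
  fixes f :: "'a::euclidean_space \<Rightarrow> real"
  assumes "open S" and nz: "\<And>x. x \<in> S \<Longrightarrow> f x \<noteq> 0"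
  shows "C_times_on m S f \<Longrightarrow> C_times_on m S (\<lambda>x. inverse (f x))"
proof (induction m)
  case 0
  then show ?case using nz by (auto intro: continuous_intros)
next
  case (Suc m)
  obtain f' where f': "\<forall>x\<in>S. (f has_derivative f' x) (at x)"
    "\<forall>b\<in>Basis. C_times_on m S (\<lambda>x. f' x b)"
    using Suc.prems unfolding C_times_on_Suc_iff[OF assms(1)] by blast
  have inv: "C_times_on m S (\<lambda>x. inverse (f x))"
    using Suc.IH Suc.prems C_times_on_Suc_imp by blast
  show ?case unfolding C_times_on_Suc_iff[OF assms(1)]
  proof (intro exI[of _ "\<lambda>x b. - (inverse (f x) * f' x b * inverse (f x))"] conjI ballI)
    show "((\<lambda>x. inverse (f x)) has_derivative (\<lambda>b. - (inverse (f x) * f' x b * inverse (f x)))) (at x)"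
      if "x \<in> S" for x
      using Deriv.has_derivative_inverse[of f x "f' x" UNIV] nz[OF that] f' that by blast
    show "C_times_on m S (\<lambda>x. - (inverse (f x) * f' x b * inverse (f x)))" if "b \<in> Basis" for b
      using f' inv that
      by (intro C_times_on_linear[OF assms(1) bounded_linear_minus[OF bounded_linear_ident]]
          C_times_on_bilinear[OF assms(1) bounded_bilinear_mult]) auto
  qed
qed

lemma C_times_on_det:
  fixes M :: "'a::euclidean_space \<Rightarrow> real^'n^'n"
  assumes "open S" "\<And>i j. C_times_on m S (\<lambda>x. M x $ i $ j)"
  shows "C_times_on m S (\<lambda>x. det (M x))"
  unfolding det_def
  by (intro C_times_on_sum C_times_on_prod C_times_on_const assms
      C_times_on_bilinear[OF assms(1) bounded_bilinear_mult])

lemma C_times_on_vec_lambda: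
  fixes f :: "'n::finite \<Rightarrow> 'a::euclidean_space \<Rightarrow> real"
  assumes "open S" "\<And>i. C_times_on m S (f i)"
  shows "C_times_on m S (\<lambda>x. \<chi> i. f i x)"
proof -
  have "(\<chi> i. f i x) = (\<Sum>i\<in>UNIV. f i x *\<^sub>R axis i 1)" for x
    by (simp add: vec_eq_iff axis_def if_distrib cong: if_cong)
  then show ?thesis
    by (simp only:) (intro C_times_on_sum assms C_times_on_const
      C_times_on_bilinear[OF assms(1) bounded_bilinear_scaleR])
qed

section \<open>Composition, integral curves and preimages of lines\<close>

lemma smooth_on_frechet_derivative:
  "smooth_on S f \<Longrightarrow> b \<in> Basis \<Longrightarrow> smooth_on S (\<lambda>x. frechet_derivative f (at x) b)"
  unfolding smooth_on_def using C_times_on.simps(2) by blast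

lemma smooth_on_imp_has_derivative:
  "smooth_on S f \<Longrightarrow> x \<in> S \<Longrightarrow> (f has_derivative frechet_derivative f (at x)) (at x)"
  unfolding smooth_on_def frechet_derivative_works[symmetric] using C_times_on.simps(2) by blast

text \<open>The outer function is smooth rather than merely of class \<open>m\<close>: its partial
  derivatives are smooth again, so the induction hypothesis applies to them. Expanding the chain
  rule in the basis turns the derivative into a sum of products of components of \<open>g'\<close>
  with partial derivatives of \<open>f\<close> composed with \<open>g\<close>.\<close>

lemma C_times_on_compose_smooth:
  assumes "open S" "open U"
  shows "smooth_on U f \<Longrightarrow> C_times_on m S g \<Longrightarrow> g ` S \<subseteq> U \<Longrightarrow> C_times_on m S (\<lambda>x. f (g x))"
proof (induction m arbitrary: f)
  case 0
  have "continuous_on U f" using 0(1) unfolding smooth_on_def by (metis C_times_on.simps(1))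
  then show ?case using 0 by (auto intro: continuous_on_compose2)
next
  case (Suc m)
  obtain g' where g': "\<forall>x\<in>S. (g has_derivative g' x) (at x)"
    "\<forall>b\<in>Basis. C_times_on m S (\<lambda>x. g' x b)"
    using Suc.prems unfolding C_times_on_Suc_iff[OF assms(1)] by blast
  let ?f' = "\<lambda>x. frechet_derivative f (at x)"
  have f': "(f has_derivative ?f' (g x)) (at (g x))" if "x \<in> S" for x
    using Suc.prems that by (intro smooth_on_imp_has_derivative) auto
  show ?case unfolding C_times_on_Suc_iff[OF assms(1)]
  proof (intro exI[of _ "\<lambda>x b. \<Sum>c\<in>Basis. (g' x b \<bullet> c) *\<^sub>R ?f' (g x) c"] conjI ballI)
    fix x assume x: "x \<in> S"
    have "((\<lambda>x. f (g x)) has_derivative (\<lambda>b. ?f' (g x) (g' x b))) (at x)"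
      using has_derivative_compose[of g "g' x" x UNIV f] f' g' x by blast
    moreover have "?f' (g x) (g' x b) = (\<Sum>c\<in>Basis. (g' x b \<bullet> c) *\<^sub>R ?f' (g x) c)" for b
    proof -
      have l: "linear (?f' (g x))" using f'[OF x] has_derivative_linear by blast
      have "?f' (g x) (g' x b) = ?f' (g x) (\<Sum>c\<in>Basis. (g' x b \<bullet> c) *\<^sub>R c)"
        by (simp add: euclidean_representation)
      then show ?thesis by (simp add: linear_sum[OF l] linear_cmul[OF l])
    qed
    ultimately show "((\<lambda>x. f (g x)) has_derivative
        (\<lambda>b. \<Sum>c\<in>Basis. (g' x b \<bullet> c) *\<^sub>R ?f' (g x) c)) (at x)" by simp
  next
    fix b :: 'a assume b: "b \<in> Basis"
    show "C_times_on m S (\<lambda>x. \<Sum>c\<in>Basis. (g' x b \<bullet> c) *\<^sub>R ?f' (g x) c)"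
      using b g' Suc.prems C_times_on_Suc_imp[OF Suc.prems(2)]
      by (intro C_times_on_sum assms C_times_on_bilinear[OF assms(1) bounded_bilinear_scaleR]
        C_times_on_linear[OF assms(1) bounded_linear_inner_left] Suc.IH
        smooth_on_frechet_derivative) auto
  qed
qed

text \<open>Bootstrapping: if \<open>\<gamma>\<close> has class \<open>m\<close>, then so does its
  derivative \<open>F (\<gamma> t)\<close>, hence \<open>\<gamma>\<close> has class
  \<open>Suc m\<close>.\<close>

lemma smooth_on_integral_curve:
  fixes \<gamma> :: "real \<Rightarrow> 'a::euclidean_space"
  assumes "open S" "open U" "smooth_on U F" "\<gamma> ` S \<subseteq> U"
    and d: "\<And>t. t \<in> S \<Longrightarrow> (\<gamma> has_vector_derivative F (\<gamma> t)) (at t)"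
  shows "smooth_on S \<gamma>"
  unfolding smooth_on_def
proof
  fix m show "C_times_on m S \<gamma>"
  proof (induction m)
    case 0
    then show ?case
      using d by (auto intro!: continuous_at_imp_continuous_on has_vector_derivative_continuous)
  next
    case (Suc m)
    have "C_times_on m S (\<lambda>t. F (\<gamma> t))"
      using assms Suc by (intro C_times_on_compose_smooth[of S U F]) auto
    then show ?case unfolding C_times_on_Suc_iff[OF assms(1)]
      using d by (intro exI[of _ "\<lambda>t h. h *\<^sub>R F (\<gamma> t)"]) (auto simp: has_vector_derivative_def)
  qed
qed

text \<open>By Cramer's rule the solution is a quotient of determinants in the entries of the
  Jacobian matrix and of \<open>b\<close>, with nonvanishing denominator.\<close>

lemma smooth_on_solve_linear:
  fixes T :: "real^'n \<Rightarrow> real^'n"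
  assumes "open U" "smooth_on U T"
    and inj: "\<And>x. x \<in> U \<Longrightarrow> inj (frechet_derivative T (at x))"
  obtains F where "smooth_on U F" "\<And>x. x \<in> U \<Longrightarrow> frechet_derivative T (at x) (F x) = b"
proof
  let ?T' = "\<lambda>x. frechet_derivative T (at x)"
  define M where "M x = matrix (?T' x)" for x
  \<comment> \<open>Numerator of component \<open>k\<close>: column \<open>k\<close> of the Jacobian
    matrix is replaced by \<open>b\<close>.\<close>
  define F where "F x = (\<chi> k. det (\<chi> i j. if j = k then b $ i else M x $ i $ j) * inverse (det (M x)))" for x
  have lin: "linear (?T' x)" if "x \<in> U" for x
    using smooth_on_imp_has_derivative[OF assms(2) that] has_derivative_linear by blast
  have M: "M x *v v = ?T' x v" if "x \<in> U" for x v
    unfolding M_def by (rule matrix_works) (use lin[OF that] in \<open>simp add: linear_matrix_vector_mul_eq\<close>)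
  have det: "det (M x) \<noteq> 0" if "x \<in> U" for x
    using det_nz_iff_inj[OF lin[OF that]] inj[OF that] M_def by auto
  show "?T' x (F x) = b" if "x \<in> U" for x
    using cramer[OF det[OF that], of "F x" b] M[OF that] by (simp add: F_def divide_inverse)
  have "C_times_on m U (\<lambda>x. M x $ i $ j)" for m i j
  proof -
    have "C_times_on m U (\<lambda>x. ?T' x (axis j 1))"
      using smooth_on_frechet_derivative[OF assms(2), of "axis j 1"]
      unfolding smooth_on_def by (auto simp: axis_in_Basis_iff)
    then show ?thesis
      unfolding M_def matrix_def
      using C_times_on_linear[OF assms(1) bounded_linear_vec_nth[of i]] by simp
  qed
  moreover have "C_times_on m U (\<lambda>x. if j = k then b $ i else M x $ i $ j)" for m i j k
    using calculation C_times_on_const by (cases "j = k") auto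
  ultimately show "smooth_on U F"
    unfolding smooth_on_def F_def using det
    by (intro allI C_times_on_vec_lambda C_times_on_det assms C_times_on_inverse
      C_times_on_bilinear[OF assms(1) bounded_bilinear_mult]) simp_all
qed

lemma has_derivative_the_inv_into:
  fixes T :: "'a::euclidean_space \<Rightarrow> 'a"
  assumes "open U" "inj_on T U" "\<And>x. x \<in> U \<Longrightarrow> (T has_derivative T' x) (at x)"
    and "\<And>x. x \<in> U \<Longrightarrow> inj (T' x)" "x \<in> U"
  shows "(the_inv_into U T has_derivative inv (T' x)) (at (T x))"
proof (rule has_derivative_inverse_strong[of U x T])
  show "continuous_on U T" using assms(3)
    by (auto intro!: continuous_at_imp_continuous_on has_derivative_continuous)
  have "linear (T' x)" using assms(3,5) has_derivative_linear by blast
  then have "surj (T' x)" using assms(4,5) linear_injective_imp_surjective by blast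
  then show "T' x \<circ> inv (T' x) = id" by (simp add: surj_iff)
qed (use assms in \<open>auto simp: the_inv_into_f_f\<close>)

text \<open>The inverse of \<open>T\<close> is only shown to be differentiable. This already makes
  the preimage of the line an integral curve of the smooth field that assigns to \<open>x\<close>
  the solution of \<open>frechet_derivative T (at x) v = b\<close>, and integral curves of smooth
  fields are smooth.\<close>

lemma smooth_curve_in_preimage_of_line:
  fixes T :: "real^'n \<Rightarrow> real^'n"
  assumes "open U" "smooth_on U T" "inj_on T U"
    and inj: "\<And>x. x \<in> U \<Longrightarrow> inj (frechet_derivative T (at x))" and "x\<^sub>0 \<in> U"
  obtains \<epsilon> \<gamma> v where "\<epsilon> > 0" "\<gamma> 0 = x\<^sub>0" "smooth_on {-\<epsilon><..<\<epsilon>::real} \<gamma>"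
    "\<And>t. t \<in> {-\<epsilon><..<\<epsilon>} \<Longrightarrow> \<gamma> t \<in> U \<and> T (\<gamma> t) = T x\<^sub>0 + t *\<^sub>R b"
    "(\<gamma> has_vector_derivative v) (at 0)" "frechet_derivative T (at x\<^sub>0) v = b"
proof -
  let ?T' = "\<lambda>x. frechet_derivative T (at x)"
  obtain F where F: "smooth_on U F" "\<And>x. x \<in> U \<Longrightarrow> ?T' x (F x) = b"
    using smooth_on_solve_linear[OF assms(1,2) inj] by blast
  define g where "g = the_inv_into U T"
  define \<gamma> where "\<gamma> t = g (T x\<^sub>0 + t *\<^sub>R b)" for t
  have d: "(T has_derivative ?T' x) (at x)" if "x \<in> U" for x
    using smooth_on_imp_has_derivative[OF assms(2) that] .
  have "continuous_on U T" using d
    by (auto intro!: continuous_at_imp_continuous_on has_derivative_continuous)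
  \<comment> \<open>Invariance of domain: a short piece of the line around its starting point stays
    inside the image of \<open>T\<close>.\<close>
  then have "open (T ` U)" using invariance_of_domain assms by blast
  then have "open ((\<lambda>t. T x\<^sub>0 + t *\<^sub>R b) -` (T ` U))"
    by (intro open_vimage continuous_intros)
  moreover have "0 \<in> (\<lambda>t. T x\<^sub>0 + t *\<^sub>R b) -` (T ` U)" using assms(5) by auto
  ultimately obtain \<epsilon> where \<epsilon>: "\<epsilon> > 0" "ball 0 \<epsilon> \<subseteq> (\<lambda>t. T x\<^sub>0 + t *\<^sub>R b) -` (T ` U)"
    using openE by blast
  have on: "\<gamma> t \<in> U \<and> T (\<gamma> t) = T x\<^sub>0 + t *\<^sub>R b" if "t \<in> {-\<epsilon><..<\<epsilon>}" for t
  proof -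
    have "t \<in> ball 0 \<epsilon>" using that by auto
    then have "T x\<^sub>0 + t *\<^sub>R b \<in> T ` U" using \<epsilon> by auto
    then show ?thesis unfolding \<gamma>_def g_def
      using f_the_inv_into_f[OF assms(3)] the_inv_into_into[OF assms(3)] by blast
  qed
  have der: "(\<gamma> has_vector_derivative F (\<gamma> t)) (at t)" if t: "t \<in> {-\<epsilon><..<\<epsilon>}" for t
  proof -
    have U: "\<gamma> t \<in> U" and e: "T (\<gamma> t) = T x\<^sub>0 + t *\<^sub>R b" using on[OF t] by auto
    have g: "(g has_derivative inv (?T' (\<gamma> t))) (at (T x\<^sub>0 + t *\<^sub>R b))"
      using has_derivative_the_inv_into[OF assms(1,3) d inj U] e unfolding g_def by simp
    have "((\<lambda>t. T x\<^sub>0 + t *\<^sub>R b) has_vector_derivative b) (at t)"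
      by (auto intro!: derivative_eq_intros)
    then have "((\<lambda>t. g (T x\<^sub>0 + t *\<^sub>R b)) has_derivative (\<lambda>h. inv (?T' (\<gamma> t)) (h *\<^sub>R b))) (at t)"
      unfolding has_vector_derivative_def using has_derivative_compose g by blast
    moreover have "inv (?T' (\<gamma> t)) (h *\<^sub>R b) = h *\<^sub>R inv (?T' (\<gamma> t)) b" for h
      using linear_cmul[OF has_derivative_linear[OF g]] .
    moreover have "inv (?T' (\<gamma> t)) b = F (\<gamma> t)"
      using inv_f_f[OF inj[OF U], of "F (\<gamma> t)"] unfolding F(2)[OF U] .
    ultimately show ?thesis unfolding \<gamma>_def has_vector_derivative_def by simp
  qed
  have g0: "\<gamma> 0 = x\<^sub>0" unfolding \<gamma>_def g_def using assms(3,5) by (simp add: the_inv_into_f_f)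
  show thesis
  proof (rule that[OF \<epsilon>(1) g0 _ on])
    show "smooth_on {-\<epsilon><..<\<epsilon>} \<gamma>"
      using on by (intro smooth_on_integral_curve[of _ U F, OF _ assms(1) F(1) _ der]) auto
    show "(\<gamma> has_vector_derivative F x\<^sub>0) (at 0)" using der[of 0] g0 \<epsilon> by auto
    show "?T' x\<^sub>0 (F x\<^sub>0) = b" using F(2) assms(5) by blast
  qed
qed

section \<open>Gradients, and derivatives of curves in a subspace\<close>

lemma grad_eqI: "GDERIV f x :> D \<Longrightarrow> grad f x = D"
  unfolding grad_def
proof (rule the_equality)
  fix D' assume "GDERIV f x :> D" "GDERIV f x :> D'"
  then have "(\<lambda>h. h \<bullet> D') = (\<lambda>h. h \<bullet> D)"
    unfolding gderiv_def by (rule has_derivative_unique[rotated])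
  then show "D' = D" by (metis vector_eq_ldot)
qed

text \<open>The sum is the Riesz representative of the functional \<open>f'\<close>.\<close>

lemma GDERIV_frechet_derivative:
  fixes f :: "real^'n \<Rightarrow> real"
  assumes "(f has_derivative f') (at x)"
  shows "GDERIV f x :> (\<Sum>b\<in>Basis. f' b *\<^sub>R b)"
proof -
  have l: "linear f'" using assms has_derivative_linear by blast
  have "f' h = h \<bullet> (\<Sum>b\<in>Basis. f' b *\<^sub>R b)" for h
  proof -
    have "f' h = f' (\<Sum>b\<in>Basis. (h \<bullet> b) *\<^sub>R b)" by (simp add: euclidean_representation)
    then show ?thesis
      by (simp add: linear_sum[OF l] linear_cmul[OF l] inner_sum_right mult.commute)
  qed
  then have "f' = (\<lambda>h. h \<bullet> (\<Sum>b\<in>Basis. f' b *\<^sub>R b))" by blast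
  with assms show ?thesis unfolding gderiv_def by simp
qed

lemma GDERIV_grad:
  fixes f :: "real^'n \<Rightarrow> real"
  assumes "(f has_derivative f') (at x)"
  shows "GDERIV f x :> grad f x"
  using GDERIV_frechet_derivative[OF assms] grad_eqI[OF GDERIV_frechet_derivative[OF assms]] by simp

lemma smooth_on_grad:
  assumes "open S" "smooth_on S f"
  shows "smooth_on S (grad f)"
proof -
  have eq: "grad f x = (\<Sum>b\<in>Basis. frechet_derivative f (at x) b *\<^sub>R b)" if "x \<in> S" for x
    using smooth_on_imp_has_derivative[OF assms(2) that]
    by (intro grad_eqI GDERIV_frechet_derivative)
  have "smooth_on S (\<lambda>x. \<Sum>b\<in>Basis. frechet_derivative f (at x) b *\<^sub>R b)"
    using smooth_on_frechet_derivative[OF assms(2)] unfolding smooth_on_def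
    by (intro allI C_times_on_sum C_times_on_bilinear[OF _ bounded_bilinear_scaleR] assms C_times_on_const) auto
  then show ?thesis
    by (rule smooth_on_cong[OF assms(1)]) (simp add: eq)
qed

text \<open>Let \<open>z\<close> be the component of \<open>v\<close> orthogonal to
  \<open>A\<close>. The pairing of the curve with \<open>z\<close> is locally constant, so
  \<open>z \<bullet> v\<close>, which is the squared length of \<open>z\<close>, vanishes.\<close>

lemma has_vector_derivative_in_subspace:
  fixes \<gamma> :: "real \<Rightarrow> 'a::euclidean_space"
  assumes "subspace A" "(\<gamma> has_vector_derivative v) (at t\<^sub>0)"
    and ev: "\<forall>\<^sub>F t in nhds t\<^sub>0. \<gamma> t - \<gamma> t\<^sub>0 \<in> A"
  shows "v \<in> A"
proof -
  obtain y z where yz: "y \<in> span A" "\<And>w. w \<in> span A \<Longrightarrow> orthogonal z w" "v = y + z"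
    using orthogonal_subspace_decomp_exists[of A v] by blast
  have "\<forall>\<^sub>F t in nhds t\<^sub>0. z \<bullet> (\<gamma> t - \<gamma> t\<^sub>0) = 0"
    using ev by eventually_elim (use yz(2) span_base in \<open>auto simp: orthogonal_def\<close>)
  then have "((\<lambda>t. z \<bullet> (\<gamma> t - \<gamma> t\<^sub>0)) has_real_derivative 0) (at t\<^sub>0)"
    by (subst DERIV_cong_ev[OF refl _ refl]) auto
  moreover have "((\<lambda>t. z \<bullet> (\<gamma> t - \<gamma> t\<^sub>0)) has_real_derivative z \<bullet> v) (at t\<^sub>0)"
    using assms(2) unfolding has_vector_derivative_def has_field_derivative_def
    by (auto intro!: derivative_eq_intros simp: mult.commute)
  ultimately have "z \<bullet> v = 0" using DERIV_unique by blast
  then have "z = 0" using yz by (auto simp: inner_add_right orthogonal_def)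
  then show ?thesis using yz(1,3) assms(1) by (metis add.right_neutral span_eq_iff)
qed

subsection \<open>Tangent spaces in a global chart\<close>

text \<open>Reduces the construction of tangent vectors to curves \<open>g\<close> in coordinates;
  the inverse chart lifts them to the manifold.\<close>

lemma tangent_spaceI:
  assumes "bij_betw c S U" "P \<in> S" "\<epsilon> > 0" "g 0 = c P" "smooth_on {-\<epsilon><..<\<epsilon>} g"
    and "(g has_vector_derivative v) (at 0)"
    and "\<And>t. t \<in> {-\<epsilon><..<\<epsilon>} \<Longrightarrow> g t \<in> U \<and> the_inv_into S c (g t) \<in> N"
  shows "v \<in> tangent_space c N P"
proof -
  define \<gamma> where "\<gamma> t = the_inv_into S c (g t)" for t
  have c: "(c \<circ> \<gamma>) t = g t" if "t \<in> {-\<epsilon><..<\<epsilon>}" for t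
    using assms(7)[OF that] assms(1) by (simp add: \<gamma>_def f_the_inv_into_f_bij_betw)
  have "smooth_on {-\<epsilon><..<\<epsilon>} (c \<circ> \<gamma>)"
    by (rule smooth_on_cong[OF open_greaterThanLessThan assms(5)]) (rule c[symmetric])
  moreover have "((c \<circ> \<gamma>) has_vector_derivative v) (at 0)"
    using assms(3) c
    by (intro has_vector_derivative_transform_within_open[OF assms(6), of "{-\<epsilon><..<\<epsilon>}"]) auto
  moreover have "\<gamma> 0 = P"
    using assms(1,2,4) by (simp add: \<gamma>_def the_inv_into_f_f bij_betw_def)
  moreover have "\<gamma> ` {-\<epsilon><..<\<epsilon>} \<subseteq> N" using assms(7) by (auto simp: \<gamma>_def)
  ultimately show ?thesis unfolding tangent_space_def using assms(3) by blast
qed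

text \<open>A direction \<open>u\<close> in \<open>A\<close> is the velocity of the straight segment
  through \<open>c P\<close>, which stays in the open chart range for short times.\<close>

lemma subspace_subset_tangent_space:
  assumes "bij_betw c S U" "open U" "P \<in> S" "subspace A"
  shows "A \<subseteq> tangent_space c {Q \<in> S. c Q - c P \<in> A} P"
proof
  fix u assume u: "u \<in> A"
  have "open ((\<lambda>t. c P + t *\<^sub>R u) -` U)" using assms(2)
    by (intro open_vimage continuous_intros)
  moreover have "0 \<in> (\<lambda>t. c P + t *\<^sub>R u) -` U"
    using assms(1,3) bij_betwE by fastforce
  ultimately obtain \<epsilon> where \<epsilon>: "\<epsilon> > 0" "ball 0 \<epsilon> \<subseteq> (\<lambda>t. c P + t *\<^sub>R u) -` U"
    using openE by blast
  show "u \<in> tangent_space c {Q \<in> S. c Q - c P \<in> A} P"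
  proof (rule tangent_spaceI[OF assms(1,3) \<epsilon>(1), of "\<lambda>t. c P + t *\<^sub>R u"])
    show "smooth_on {-\<epsilon><..<\<epsilon>} (\<lambda>t. c P + t *\<^sub>R u)" unfolding smooth_on_def
      by (intro allI C_times_on_add C_times_on_const C_times_on_linear[OF _ bounded_linear_scaleR_left]
        C_times_on_ident open_greaterThanLessThan)
    show "((\<lambda>t. c P + t *\<^sub>R u) has_vector_derivative u) (at 0)"
      by (auto intro!: derivative_eq_intros)
    fix t :: real assume "t \<in> {-\<epsilon><..<\<epsilon>}"
    then have "t \<in> ball 0 \<epsilon>" by auto
    then have U: "c P + t *\<^sub>R u \<in> U" using \<epsilon> by auto
    then show "c P + t *\<^sub>R u \<in> U \<and> the_inv_into S c (c P + t *\<^sub>R u) \<in> {Q \<in> S. c Q - c P \<in> A}"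
      using assms u
      by (auto simp: f_the_inv_into_f_bij_betw bij_betw_def subspace_scale intro!: the_inv_into_into f_the_inv_into_f)
  qed simp
qed

text \<open>Stated for an arbitrary \<open>T\<close> so that the identity gives the primal case and
  the dual map gives the dual case.\<close>

lemma tangent_space_image_in_subspace:
  fixes T :: "real^'n \<Rightarrow> 'b::euclidean_space"
  assumes "subspace B" "(T has_derivative T') (at (c P))"
    and "v \<in> tangent_space c {Q \<in> S. T (c Q) - T (c P) \<in> B} P"
  shows "T' v \<in> B"
proof -
  obtain \<gamma> \<epsilon> where \<epsilon>: "\<epsilon> > 0" "\<gamma> ` {-\<epsilon><..<\<epsilon>} \<subseteq> {Q \<in> S. T (c Q) - T (c P) \<in> B}" and \<gamma>0: "\<gamma> 0 = P"
    and d: "((c \<circ> \<gamma>) has_derivative (\<lambda>h. h *\<^sub>R v)) (at (0::real))"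
    using assms(3) unfolding tangent_space_def has_vector_derivative_def mem_Collect_eq by (elim exE conjE)
  have l: "linear T'" using assms(2) has_derivative_linear by blast
  have T': "(T has_derivative T') (at ((c \<circ> \<gamma>) 0))" using assms(2) \<gamma>0 by simp
  have "((\<lambda>t. T ((c \<circ> \<gamma>) t)) has_vector_derivative T' v) (at 0)"
    using has_derivative_compose[OF d T']
    unfolding has_vector_derivative_def linear_cmul[OF l] .
  moreover have "\<forall>\<^sub>F t in nhds 0. T ((c \<circ> \<gamma>) t) - T ((c \<circ> \<gamma>) 0) \<in> B"
  proof (rule eventually_mono)
    show "\<forall>\<^sub>F t in nhds 0. t \<in> {-\<epsilon><..<\<epsilon>}"
      using \<epsilon>(1) by (intro eventually_nhds_in_open) auto
    fix t assume "t \<in> {-\<epsilon><..<\<epsilon>}"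
    then have "\<gamma> t \<in> {Q \<in> S. T (c Q) - T (c P) \<in> B}" using \<epsilon>(2) by blast
    then show "T ((c \<circ> \<gamma>) t) - T ((c \<circ> \<gamma>) 0) \<in> B" using \<gamma>0 by simp
  qed
  ultimately show ?thesis by (rule has_vector_derivative_in_subspace[OF assms(1)])
qed

text \<open>Any point of the submanifold can serve as base point, since the difference of the two
  base points lies in the direction space.\<close>

lemma maximal_autoparallel_basepoint:
  assumes "maximal_autoparallel S c k N" "P \<in> N"
  obtains A where "subspace A" "dim A = k" "N = {Q \<in> S. c Q - c P \<in> A}" "P \<in> S"
proof -
  obtain P' A where A: "P' \<in> S" "subspace A" "dim A = k" "N = {Q \<in> S. c Q - c P' \<in> A}"
    using assms(1) unfolding maximal_autoparallel_def by blast
  have P: "c P - c P' \<in> A" "P \<in> S" using assms(2) A by auto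
  have "c Q - c P' \<in> A \<longleftrightarrow> c Q - c P \<in> A" for Q
    using subspace_diff[OF A(2) _ P(1), of "c Q - c P'"] subspace_add[OF A(2) _ P(1), of "c Q - c P"]
    by auto
  then show thesis using that A P by auto
qed

subsection \<open>The dual map and the metric\<close>

locale alpha_exp_concave =
  fixes \<alpha> :: real and \<Theta> :: "(real^'n) set" and \<phi> :: "real^'n \<Rightarrow> real"
  assumes \<alpha>_pos: "\<alpha> > 0"
    and open_\<Theta>: "open \<Theta>" and convex_\<Theta>: "convex \<Theta>"
    and smooth: "smooth_on \<Theta> \<phi>"
    and negative_definite_hessian:
      "\<And>x. x \<in> \<Theta> \<Longrightarrow> negative_definite (hessian (\<lambda>x. exp (\<alpha> * \<phi> x)) x)"
    and dual_pos: "\<And>x. x \<in> \<Theta> \<Longrightarrow> 1 - \<alpha> * (grad \<phi> x \<bullet> x) > 0"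
begin

abbreviation "G \<equiv> grad \<phi>"
abbreviation "H x \<equiv> frechet_derivative G (at x)"
abbreviation "T \<equiv> dual_map \<alpha> \<phi>"

text \<open>The operator \<open>Q\<close> of the overview, that is, the Hessian of
  \<open>exp (\<alpha> * \<phi> x)\<close> divided by the positive number
  \<open>\<alpha> * exp (\<alpha> * \<phi> x)\<close>.\<close>

definition neg_metric :: "real^'n \<Rightarrow> real^'n \<Rightarrow> real^'n" where
  "neg_metric x v = H x v + (\<alpha> * (G x \<bullet> v)) *\<^sub>R G x"

text \<open>The operator \<open>J\<close> of the overview: the identity plus a rank-one term in the
  direction of the dual coordinates.\<close>

definition dual_twist :: "real^'n \<Rightarrow> real^'n \<Rightarrow> real^'n" where
  "dual_twist x b = b + (\<alpha> * (x \<bullet> b)) *\<^sub>R T x"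

text \<open>On \<open>\<Theta>\<close> this is the factor
  \<open>1 + \<alpha> * (T x \<bullet> x)\<close> of the overview.\<close>

definition dual_scale :: "real^'n \<Rightarrow> real" where
  "dual_scale x = 1 / (1 - \<alpha> * (G x \<bullet> x))"

lemma has_derivative_phi: "x \<in> \<Theta> \<Longrightarrow> (\<phi> has_derivative (\<lambda>h. h \<bullet> G x)) (at x)"
  using GDERIV_grad[OF smooth_on_imp_has_derivative[OF smooth]] by (simp add: gderiv_def)

lemma smooth_grad: "smooth_on \<Theta> G"
  using smooth_on_grad open_\<Theta> smooth by blast

lemma has_derivative_grad: "x \<in> \<Theta> \<Longrightarrow> (G has_derivative H x) (at x)"
  using smooth_on_imp_has_derivative[OF smooth_grad] .

lemma linear_H: "x \<in> \<Theta> \<Longrightarrow> linear (H x)"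
  using has_derivative_grad has_derivative_linear by blast

lemma linear_neg_metric: "x \<in> \<Theta> \<Longrightarrow> linear (neg_metric x)"
  using linear_H[of x] unfolding neg_metric_def
  by (auto intro!: linearI simp: linear_add linear_cmul algebra_simps scaleR_add_left)

lemma hessian_exp:
  assumes x: "x \<in> \<Theta>"
  shows "hessian (\<lambda>x. exp (\<alpha> * \<phi> x)) x *v v = (\<alpha> * exp (\<alpha> * \<phi> x)) *\<^sub>R neg_metric x v"
proof -
  let ?\<Phi> = "\<lambda>x. exp (\<alpha> * \<phi> x)"
  have g: "grad ?\<Phi> y = (\<alpha> * ?\<Phi> y) *\<^sub>R G y" if "y \<in> \<Theta>" for y
    by (rule grad_eqI)
      (auto intro!: derivative_eq_intros has_derivative_phi that simp: gderiv_def algebra_simps)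
  have "((\<lambda>y. (\<alpha> * ?\<Phi> y) *\<^sub>R G y) has_derivative (\<lambda>v. (\<alpha> * ?\<Phi> x) *\<^sub>R neg_metric x v)) (at x)"
    by (auto intro!: derivative_eq_intros has_derivative_phi has_derivative_grad x
        simp: neg_metric_def algebra_simps inner_commute)
  \<comment> \<open>The gradient formula holds throughout the open set \<open>\<Theta>\<close>,
    which suffices to determine the derivative at \<open>x\<close>.\<close>
  then have d: "(grad ?\<Phi> has_derivative (\<lambda>v. (\<alpha> * ?\<Phi> x) *\<^sub>R neg_metric x v)) (at x)"
    by (rule has_derivative_transform_within_open[OF _ open_\<Theta> x g[symmetric]])
  then have "grad ?\<Phi> differentiable (at x)" by (rule differentiableI)
  then have "(grad ?\<Phi> has_derivative (\<lambda>v. hessian ?\<Phi> x *v v)) (at x)"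
    unfolding hessian_def jacobian_works .
  from has_derivative_unique[OF this d] show ?thesis by metis
qed

lemma neg_metric_negative: "x \<in> \<Theta> \<Longrightarrow> v \<noteq> 0 \<Longrightarrow> v \<bullet> neg_metric x v < 0"
  using negative_definite_hessian[of x] \<alpha>_pos unfolding negative_definite_def
  by (auto simp: hessian_exp mult_less_0_iff)

section \<open>Strict tangent inequality and injectivity of the dual map\<close>

text \<open>Along the segment from \<open>x\<close> to \<open>y\<close> the function
  \<open>h\<close>, which is \<open>exp (\<alpha> * \<phi>)\<close>, has negative second derivative.
  By the mean value theorem \<open>h 1 - h 0\<close> is a value of \<open>h1\<close> at an interior
  point, hence smaller than \<open>h1 0\<close>; division by \<open>h 0\<close> gives the
  claim.\<close>

lemma tangent_strict:
  assumes x: "x \<in> \<Theta>" and y: "y \<in> \<Theta>" and "x \<noteq> y"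
  shows "exp (\<alpha> * (\<phi> y - \<phi> x)) < 1 + \<alpha> * (G x \<bullet> (y - x))"
proof -
  define u where "u = y - x"
  define p where "p t = x + t *\<^sub>R u" for t
  define h where "h t = exp (\<alpha> * \<phi> (p t))" for t
  define h1 where "h1 t = \<alpha> * exp (\<alpha> * \<phi> (p t)) * (G (p t) \<bullet> u)" for t
  define h2 where "h2 t = \<alpha> * exp (\<alpha> * \<phi> (p t)) * (u \<bullet> neg_metric (p t) u)" for t
  have p: "p t \<in> \<Theta>" if "0 \<le> t" "t \<le> 1" for t
    using convexD_alt[OF convex_\<Theta> x y, of t] that by (simp add: p_def u_def algebra_simps)
  have dp: "(p has_derivative (\<lambda>s. s *\<^sub>R u)) (at t)" for t
    unfolding p_def by (auto intro!: derivative_eq_intros)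
  have d\<phi>: "((\<lambda>t. \<phi> (p t)) has_derivative (\<lambda>s. (s *\<^sub>R u) \<bullet> G (p t))) (at t)" if "0 \<le> t" "t \<le> 1" for t
    using has_derivative_compose[OF dp has_derivative_phi[OF p[OF that]]] .
  have dG: "((\<lambda>t. G (p t)) has_derivative (\<lambda>s. s *\<^sub>R H (p t) u)) (at t)" if "0 \<le> t" "t \<le> 1" for t
    using has_derivative_compose[OF dp has_derivative_grad[OF p[OF that]]]
    by (simp add: linear_cmul[OF linear_H[OF p[OF that]]])
  have dh: "(h has_real_derivative h1 t) (at t)" if "0 \<le> t" "t \<le> 1" for t
    unfolding h_def h1_def has_field_derivative_def
    by (auto intro!: derivative_eq_intros d\<phi> that simp: algebra_simps inner_commute)
  have dh1: "(h1 has_real_derivative h2 t) (at t)" if "0 \<le> t" "t \<le> 1" for t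
    unfolding h1_def h2_def neg_metric_def has_field_derivative_def
    by (auto intro!: derivative_eq_intros d\<phi> dG that simp: algebra_simps inner_commute)
  have "u \<noteq> 0" using assms(3) by (simp add: u_def)
  then have h2: "h2 t < 0" if "0 \<le> t" "t \<le> 1" for t
    using neg_metric_negative[OF p[OF that]] \<alpha>_pos by (simp add: h2_def mult_less_0_iff)
  obtain s where s: "0 < s" "s < 1" "h 1 - h 0 = (1 - 0) * h1 s"
    using MVT2[of 0 1 h h1] dh by auto
  have "h1 s < h1 0"
    using s dh1 h2 by (intro DERIV_neg_imp_decreasing[of 0 s h1]) force+
  then have "h 1 < h 0 * (1 + \<alpha> * (G x \<bullet> u))"
    using s(3) by (simp add: h_def h1_def p_def algebra_simps)
  then have "h 1 / h 0 < 1 + \<alpha> * (G x \<bullet> u)" by (simp add: h_def divide_simps mult.commute)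
  then show ?thesis by (simp add: h_def p_def u_def right_diff_distrib exp_diff)
qed

text \<open>Keeps the argument of the logarithm in the divergence positive: for distinct points it
  exceeds an exponential.\<close>

lemma L_arg_pos: "x \<in> \<Theta> \<Longrightarrow> y \<in> \<Theta> \<Longrightarrow> 1 + \<alpha> * (G x \<bullet> (y - x)) > 0"
  using tangent_strict[of x y] exp_gt_zero[of "\<alpha> * (\<phi> y - \<phi> x)"] by (cases "x = y") (simp, linarith)

lemma dual_scale_pos: "x \<in> \<Theta> \<Longrightarrow> dual_scale x > 0"
  using dual_pos by (simp add: dual_scale_def)

lemma dual_map_eq: "T x = dual_scale x *\<^sub>R G x"
  by (simp add: dual_map_def dual_scale_def)

text \<open>Links the dual coordinates to the argument of the logarithm in the divergence.\<close>

lemma one_plus_dual: "x \<in> \<Theta> \<Longrightarrow> 1 + \<alpha> * (T x \<bullet> y) = dual_scale x * (1 + \<alpha> * (G x \<bullet> (y - x)))"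
  using dual_pos[of x] by (simp add: dual_map_eq dual_scale_def field_simps inner_diff_right)

lemma one_plus_dual_self: "x \<in> \<Theta> \<Longrightarrow> 1 + \<alpha> * (T x \<bullet> x) = dual_scale x"
  using one_plus_dual[of x x] by simp

lemma linear_dual_twist: "linear (dual_twist x)"
  unfolding dual_twist_def by (auto intro!: linearI simp: algebra_simps)

text \<open>In other words, \<open>x\<close> is an eigenvector of the adjoint of
  \<open>dual_twist x\<close>. This recovers \<open>x \<bullet> b\<close> from the twisted
  vector.\<close>

lemma inner_dual_twist: "x \<in> \<Theta> \<Longrightarrow> x \<bullet> dual_twist x b = dual_scale x * (x \<bullet> b)"
  by (simp add: dual_twist_def one_plus_dual_self[symmetric] algebra_simps inner_commute)

text \<open>A vector in the kernel is orthogonal to \<open>x\<close>, and on such vectors the twist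
  is the identity.\<close>

lemma inj_dual_twist:
  assumes "x \<in> \<Theta>" shows "inj (dual_twist x)"
  unfolding linear_injective_0[OF linear_dual_twist]
proof (intro allI impI)
  fix b assume 0: "dual_twist x b = 0"
  then have "x \<bullet> b = 0" using inner_dual_twist[OF assms, of b] dual_scale_pos[OF assms] by simp
  with 0 show "b = 0" by (simp add: dual_twist_def)
qed

text \<open>Core of the intersection claim and of the injectivity of the dual map. Eliminating
  \<open>b\<close> from the two hypotheses yields \<open>D x y * D y x = 1\<close>, while the strict
  tangent inequality in both directions makes this product larger than 1.\<close>

lemma eq_of_orthogonal_dual_difference:
  assumes x: "x \<in> \<Theta>" and y: "y \<in> \<Theta>" and b: "T y - T x = dual_twist x b" and o: "(y - x) \<bullet> b = 0"
  shows "y = x"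
proof (rule ccontr)
  assume "y \<noteq> x"
  define D where "D x y = 1 + \<alpha> * (G x \<bullet> (y - x))" for x y
  have "x \<bullet> (T y - T x) = dual_scale x * (x \<bullet> b)" using b inner_dual_twist[OF x] by simp
  moreover have "(y - x) \<bullet> (T y - T x) = \<alpha> * (x \<bullet> b) * ((y - x) \<bullet> T x)"
    using o unfolding b by (simp add: dual_twist_def inner_add_right)
  \<comment> \<open>Orthogonality leaves only the rank-one term of the twist; multiplying by
    \<open>dual_scale x\<close> eliminates \<open>x \<bullet> b\<close>, the last trace of
    \<open>b\<close>.\<close>
  ultimately have "dual_scale x * ((y - x) \<bullet> (T y - T x)) = \<alpha> * (x \<bullet> (T y - T x)) * ((y - x) \<bullet> T x)"
    by simp
  then have "(1 + \<alpha> * (T x \<bullet> x)) * (\<alpha> * ((y - x) \<bullet> (T y - T x)))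
      = \<alpha> * (\<alpha> * (x \<bullet> (T y - T x)) * ((y - x) \<bullet> T x))"
    by (simp add: one_plus_dual_self[OF x])
  \<comment> \<open>Expanded, the relation says that the 2 by 2 matrix of the numbers 1 + \<alpha>
    (T p . q), with p and q ranging over \<open>x\<close> and \<open>y\<close>, has determinant
    zero.\<close>
  then have "(1 + \<alpha> * (T x \<bullet> x)) * (1 + \<alpha> * (T y \<bullet> y)) = (1 + \<alpha> * (T x \<bullet> y)) * (1 + \<alpha> * (T y \<bullet> x))"
    by (simp add: inner_diff_left inner_diff_right inner_commute algebra_simps)
  then have "dual_scale x * dual_scale y = (dual_scale x * D x y) * (dual_scale y * D y x)"
    by (simp only: one_plus_dual_self[OF x] one_plus_dual_self[OF y] one_plus_dual[OF x, of y]
        one_plus_dual[OF y, of x] D_def)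
  then have "D x y * D y x = 1" using dual_scale_pos[OF x] dual_scale_pos[OF y] by simp
  moreover have "exp (\<alpha> * (\<phi> y - \<phi> x)) * exp (\<alpha> * (\<phi> x - \<phi> y)) < D x y * D y x"
    using tangent_strict[OF x y] tangent_strict[OF y x] \<open>y \<noteq> x\<close> unfolding D_def
    by (intro mult_strict_mono') auto
  ultimately show False by (simp add: exp_add[symmetric] algebra_simps)
qed

text \<open>The case \<open>b = 0\<close>, where orthogonality is trivial.\<close>

lemma inj_on_dual_map: "inj_on T \<Theta>"
  using eq_of_orthogonal_dual_difference[of _ _ 0] by (force simp: inj_on_def dual_twist_def)

section \<open>Smoothness and derivative of the dual map\<close>

lemma smooth_dual_map: "smooth_on \<Theta> T"
  unfolding smooth_on_def
proof
  fix m
  have G: "C_times_on m \<Theta> G" using smooth_grad by (simp add: smooth_on_def)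
  have "C_times_on m \<Theta> (\<lambda>x. inverse (1 + (- \<alpha>) * (G x \<bullet> x)) *\<^sub>R G x)"
    using dual_pos
    by (intro C_times_on_bilinear[OF open_\<Theta> bounded_bilinear_scaleR] C_times_on_inverse open_\<Theta> G
        C_times_on_add C_times_on_const C_times_on_bilinear[OF open_\<Theta> bounded_bilinear_mult]
        C_times_on_bilinear[OF open_\<Theta> bounded_bilinear_inner] C_times_on_ident) force
  then show "C_times_on m \<Theta> T"
    by (simp add: dual_map_def[abs_def] divide_inverse)
qed

text \<open>The quotient rule, rearranged so that the derivative factors through
  \<open>neg_metric\<close>. This factorization turns metric orthogonality into a linear condition
  on dual directions.\<close>

lemma has_derivative_dual_map:
  assumes x: "x \<in> \<Theta>"
  shows "(T has_derivative (\<lambda>v. dual_scale x *\<^sub>R dual_twist x (neg_metric x v))) (at x)"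
proof -
  define c where "c = 1 - \<alpha> * (G x \<bullet> x)"
  have c: "c > 0" using dual_pos[OF x] by (simp add: c_def)
  have fc: "dual_scale x = 1 / c" by (simp add: dual_scale_def c_def)
  have Gx: "\<alpha> * (x \<bullet> G x) = 1 - c" by (simp add: c_def inner_commute)
  have "((\<lambda>x. inverse (1 - \<alpha> * (G x \<bullet> x)) *\<^sub>R G x) has_derivative
      (\<lambda>v. inverse c *\<^sub>R H x v + (inverse c * (\<alpha> * (G x \<bullet> v + H x v \<bullet> x)) * inverse c) *\<^sub>R G x)) (at x)"
    using c unfolding c_def
    by (auto intro!: derivative_eq_intros has_derivative_grad x)
  \<comment> \<open>Both sides combine \<open>H x v\<close> and \<open>G x\<close>. Comparing the
    coefficients of \<open>G x\<close> uses \<open>x \<bullet> neg_metric x v\<close>, in which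
    \<open>\<alpha> * (x \<bullet> G x)\<close> is replaced by \<open>1 - c\<close>.\<close>
  moreover have "inverse c *\<^sub>R H x v + (inverse c * (\<alpha> * (G x \<bullet> v + H x v \<bullet> x)) * inverse c) *\<^sub>R G x
      = dual_scale x *\<^sub>R dual_twist x (neg_metric x v)" for v
  proof -
    have "x \<bullet> neg_metric x v = x \<bullet> H x v + (\<alpha> * (x \<bullet> G x)) * (G x \<bullet> v)"
      by (simp add: neg_metric_def inner_add_right)
    then have xQ: "x \<bullet> neg_metric x v = x \<bullet> H x v + (1 - c) * (G x \<bullet> v)" unfolding Gx .
    have "inverse c * (\<alpha> * (G x \<bullet> v + H x v \<bullet> x)) * inverse c
        = dual_scale x * (\<alpha> * (G x \<bullet> v)) + dual_scale x * (\<alpha> * (x \<bullet> neg_metric x v)) * dual_scale x"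
      using c unfolding xQ fc by (simp add: field_simps inner_commute)
    then show ?thesis
      unfolding dual_twist_def neg_metric_def[of x v] dual_map_eq
      using fc by (simp add: scaleR_add_right scaleR_add_left neg_metric_def divide_inverse)
  qed
  ultimately show ?thesis
    unfolding dual_map_def[abs_def] divide_inverse by simp
qed

lemma frechet_derivative_dual_map:
  "x \<in> \<Theta> \<Longrightarrow> frechet_derivative T (at x) = (\<lambda>v. dual_scale x *\<^sub>R dual_twist x (neg_metric x v))"
  using frechet_derivative_at[OF has_derivative_dual_map] by simp

text \<open>All three factors of the derivative are injective: a positive scalar, the twist, and a
  negative definite operator.\<close>

lemma inj_frechet_derivative_dual_map:
  assumes x: "x \<in> \<Theta>" shows "inj (frechet_derivative T (at x))"
proof -
  have "linear (\<lambda>v. dual_scale x *\<^sub>R dual_twist x (neg_metric x v))"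
    using has_derivative_dual_map[OF x] has_derivative_linear by blast
  moreover have "v = 0" if "dual_scale x *\<^sub>R dual_twist x (neg_metric x v) = 0" for v
  proof -
    have "dual_twist x (neg_metric x v) = dual_twist x 0" using that dual_scale_pos[OF x] linear_0[OF linear_dual_twist] by simp
    then have "neg_metric x v = 0" using inj_dual_twist[OF x] by (metis injD)
    then show ?thesis using neg_metric_negative[OF x, of v] by force
  qed
  ultimately show ?thesis
    unfolding frechet_derivative_dual_map[OF x] using linear_injective_0 by blast
qed

section \<open>The Eguchi metric of the divergence\<close>

text \<open>The first argument \<open>y\<close> stays general here because the metric requires a
  further derivative in it before \<open>y\<close> is set to \<open>x\<close>.\<close>

lemma partial_L_divergence:
  assumes x: "x \<in> \<Theta>" and y: "y \<in> \<Theta>"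
  shows "partial j (\<lambda>z. L_divergence \<alpha> \<phi> y z) x =
    (H x (axis j 1) \<bullet> (y - x) - G x \<bullet> axis j 1) / (1 + \<alpha> * (G x \<bullet> (y - x))) + G x \<bullet> axis j 1"
proof -
  let ?e = "axis j 1 :: real^'n"
  have p: "((\<lambda>t. x + t *\<^sub>R ?e) has_derivative (\<lambda>s. s *\<^sub>R ?e)) (at 0)"
    by (auto intro!: derivative_eq_intros)
  have d\<phi>: "((\<lambda>t. \<phi> (x + t *\<^sub>R ?e)) has_derivative (\<lambda>s. (s *\<^sub>R ?e) \<bullet> G x)) (at 0)"
    by (rule has_derivative_compose[OF p]) (simp add: has_derivative_phi[OF x])
  have dG: "((\<lambda>t. G (x + t *\<^sub>R ?e)) has_derivative (\<lambda>s. s *\<^sub>R H x ?e)) (at 0)"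
    unfolding linear_cmul[OF linear_H[OF x], symmetric]
    by (rule has_derivative_compose[OF p]) (simp add: has_derivative_grad[OF x])
  define w where "w t = G (x + t *\<^sub>R ?e) \<bullet> (y - (x + t *\<^sub>R ?e))" for t
  have dw: "(w has_real_derivative (H x ?e \<bullet> (y - x) - G x \<bullet> ?e)) (at 0)"
    unfolding w_def has_field_derivative_def
    by (auto intro!: derivative_eq_intros dG simp: algebra_simps)
  have d\<phi>': "((\<lambda>t. \<phi> (x + t *\<^sub>R ?e)) has_real_derivative G x \<bullet> ?e) (at 0)"
    using d\<phi> unfolding has_field_derivative_def by (simp add: inner_commute mult_commute_abs)
  have w0: "1 + \<alpha> * w 0 > 0" using L_arg_pos[OF x y] by (simp add: w_def)
  have "((\<lambda>t. 1 / \<alpha> * ln (1 + \<alpha> * w t) - (\<phi> y - \<phi> (x + t *\<^sub>R ?e))) has_real_derivative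
      (H x ?e \<bullet> (y - x) - G x \<bullet> ?e) / (1 + \<alpha> * w 0) + G x \<bullet> ?e) (at 0)"
    using w0 \<alpha>_pos
    by (auto intro!: derivative_eq_intros dw d\<phi>')
  then have "((\<lambda>t. L_divergence \<alpha> \<phi> y (x + t *\<^sub>R ?e)) has_real_derivative
      (H x ?e \<bullet> (y - x) - G x \<bullet> ?e) / (1 + \<alpha> * (G x \<bullet> (y - x))) + G x \<bullet> ?e) (at 0)"
    by (simp add: L_divergence_def w_def)
  then show ?thesis unfolding partial_def by (rule DERIV_imp_deriv)
qed

lemma eguchi_metric_L_divergence:
  assumes x: "x \<in> \<Theta>"
  shows "eguchi_metric (L_divergence \<alpha> \<phi>) x $ i $ j = - (axis i 1 \<bullet> neg_metric x (axis j 1))"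
proof -
  let ?e = "axis i 1 :: real^'n" and ?d = "axis j 1 :: real^'n"
  let ?K = "\<lambda>y. (H x ?d \<bullet> (y - x) - G x \<bullet> ?d) / (1 + \<alpha> * (G x \<bullet> (y - x))) + G x \<bullet> ?d"
  have "open ((\<lambda>t. x + t *\<^sub>R ?e) -` \<Theta>)" using open_\<Theta>
    by (intro open_vimage continuous_intros)
  \<comment> \<open>The formula for the inner derivative holds for first arguments in
    \<open>\<Theta>\<close>, which covers all small \<open>t\<close>.\<close>
  then have ev: "\<forall>\<^sub>F t in nhds 0. x + t *\<^sub>R ?e \<in> \<Theta>"
    using eventually_nhds_in_open[of "(\<lambda>t. x + t *\<^sub>R ?e) -` \<Theta>" 0] x by simp
  have "((\<lambda>t. ?K (x + t *\<^sub>R ?e)) has_real_derivative ?e \<bullet> neg_metric x ?d) (at 0)"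
    unfolding has_field_derivative_def
    by (auto intro!: derivative_eq_intros simp: neg_metric_def algebra_simps inner_commute)
  moreover have "\<forall>\<^sub>F t in nhds 0. partial j (\<lambda>z. L_divergence \<alpha> \<phi> (x + t *\<^sub>R ?e) z) x = ?K (x + t *\<^sub>R ?e)"
    using ev by eventually_elim (rule partial_L_divergence[OF x])
  ultimately have "((\<lambda>t. partial j (\<lambda>z. L_divergence \<alpha> \<phi> (x + t *\<^sub>R ?e) z) x)
      has_real_derivative ?e \<bullet> neg_metric x ?d) (at 0)"
    by (subst DERIV_cong_ev[OF refl _ refl])
  then have "partial i (\<lambda>y. partial j (\<lambda>z. L_divergence \<alpha> \<phi> y z) x) x = ?e \<bullet> neg_metric x ?d"
    unfolding partial_def[of i] by (rule DERIV_imp_deriv)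
  then show ?thesis by (simp add: eguchi_metric_def)
qed

lemma inner_at_L_divergence:
  assumes x: "c P \<in> \<Theta>"
  shows "inner_at c (L_divergence \<alpha> \<phi>) P u v = - (u \<bullet> neg_metric (c P) v)"
proof -
  have e: "z = (\<Sum>i\<in>UNIV. (z $ i) *\<^sub>R axis i 1)" for z :: "real^'n"
    using basis_expansion[of z] by (simp add: scalar_mult_eq_scaleR)
  note l = linear_neg_metric[OF x]
  have "u \<bullet> neg_metric (c P) v = (\<Sum>i\<in>UNIV. (u $ i) *\<^sub>R axis i 1) \<bullet> neg_metric (c P) (\<Sum>j\<in>UNIV. (v $ j) *\<^sub>R axis j 1)"
    using e[of u] e[of v] by simp
  also have "\<dots> = (\<Sum>i\<in>UNIV. \<Sum>j\<in>UNIV. (axis i 1 \<bullet> neg_metric (c P) (axis j 1)) * u $ i * v $ j)"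
    by (subst sum.swap) (simp add: linear_sum[OF l] linear_cmul[OF l] inner_sum_left
        inner_sum_right sum_distrib_left mult_ac)
  finally show ?thesis
    by (simp add: inner_at_def eguchi_metric_L_divergence[OF x] sum_negf)
qed

subsection \<open>Orthogonal autoparallel submanifolds\<close>

text \<open>The space \<open>B\<close> of the overview: the directions, in dual coordinates, of the
  tangent vectors metrically orthogonal to \<open>A\<close>.\<close>

definition dual_complement :: "real^'n \<Rightarrow> (real^'n) set \<Rightarrow> (real^'n) set" where
  "dual_complement x A = dual_twist x ` {b. \<forall>a\<in>A. orthogonal a b}"

lemma subspace_dual_complement: "subspace (dual_complement x A)"
  unfolding dual_complement_def
  by (intro linear_subspace_image linear_dual_twist subspace_orthogonal_to_vectors)

lemma dim_dual_complement:
  assumes "x \<in> \<Theta>" "subspace A"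
  shows "dim (dual_complement x A) = CARD('n) - dim A"
proof -
  have "dim {b. \<forall>a\<in>A. orthogonal a b} + dim A = CARD('n)"
    using dim_subspace_orthogonal_to_vectors[OF assms(2) subspace_UNIV] by simp
  moreover have "dim (dual_complement x A) = dim {b. \<forall>a\<in>A. orthogonal a b}"
    unfolding dual_complement_def
    by (rule dim_image_eq[OF linear_dual_twist]) (rule inj_on_subset[OF inj_dual_twist[OF assms(1)] subset_UNIV])
  ultimately show ?thesis by simp
qed

text \<open>The derivative sends \<open>v\<close> to a positive multiple of the twist of
  \<open>neg_metric x v\<close>, and the twist is injective, so membership says exactly that
  \<open>neg_metric x v\<close> is orthogonal to \<open>A\<close>.\<close>

lemma frechet_derivative_in_dual_complement:
  assumes x: "x \<in> \<Theta>"
  shows "frechet_derivative T (at x) v \<in> dual_complement x A \<longleftrightarrow> (\<forall>u\<in>A. u \<bullet> neg_metric x v = 0)"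
proof
  assume "frechet_derivative T (at x) v \<in> dual_complement x A"
  then have "dual_scale x *\<^sub>R dual_twist x (neg_metric x v) \<in> dual_complement x A"
    by (simp add: frechet_derivative_dual_map[OF x])
  from subspace_scale[OF subspace_dual_complement this, of "1 / dual_scale x"]
  have "dual_twist x (neg_metric x v) \<in> dual_complement x A" using dual_scale_pos[OF x] by simp
  then have "neg_metric x v \<in> {b. \<forall>a\<in>A. orthogonal a b}"
    unfolding dual_complement_def inj_image_mem_iff[OF inj_dual_twist[OF x]] .
  then show "\<forall>u\<in>A. u \<bullet> neg_metric x v = 0" by (simp add: orthogonal_def)
next
  assume "\<forall>u\<in>A. u \<bullet> neg_metric x v = 0"
  then have "dual_twist x (neg_metric x v) \<in> dual_complement x A"
    unfolding dual_complement_def by (auto simp: orthogonal_def)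
  then show "frechet_derivative T (at x) v \<in> dual_complement x A"
    using subspace_scale[OF subspace_dual_complement] by (simp add: frechet_derivative_dual_map[OF x])
qed

text \<open>Supplies enough tangent vectors for uniqueness: every direction in \<open>B\<close> is
  realized by the preimage of a line in dual coordinates.\<close>

lemma tangent_space_dual_surj:
  assumes "bij_betw \<theta> S \<Theta>" "P \<in> S" "subspace B" "b \<in> B"
  obtains v where "v \<in> tangent_space \<theta> {R \<in> S. T (\<theta> R) - T (\<theta> P) \<in> B} P"
    "frechet_derivative T (at (\<theta> P)) v = b"
proof -
  have P: "\<theta> P \<in> \<Theta>" using assms(1,2) bij_betwE by blast
  obtain \<epsilon> \<gamma> v where \<gamma>: "\<epsilon> > 0" "\<gamma> 0 = \<theta> P" "smooth_on {-\<epsilon><..<\<epsilon>::real} \<gamma>"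
    "\<And>t. t \<in> {-\<epsilon><..<\<epsilon>} \<Longrightarrow> \<gamma> t \<in> \<Theta> \<and> T (\<gamma> t) = T (\<theta> P) + t *\<^sub>R b"
    "(\<gamma> has_vector_derivative v) (at 0)" "frechet_derivative T (at (\<theta> P)) v = b"
    using smooth_curve_in_preimage_of_line[OF open_\<Theta> smooth_dual_map inj_on_dual_map
      inj_frechet_derivative_dual_map P] by blast
  have "v \<in> tangent_space \<theta> {R \<in> S. T (\<theta> R) - T (\<theta> P) \<in> B} P"
  proof (rule tangent_spaceI[OF assms(1,2) \<gamma>(1,2,3,5)])
    fix t assume t: "t \<in> {-\<epsilon><..<\<epsilon>}"
    have "\<gamma> t \<in> \<theta> ` S" using \<gamma>(4)[OF t] assms(1) by (simp add: bij_betw_def)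
    then have "the_inv_into S \<theta> (\<gamma> t) \<in> S" "\<theta> (the_inv_into S \<theta> (\<gamma> t)) = \<gamma> t"
      using the_inv_into_into[OF bij_betw_imp_inj_on[OF assms(1)] _ order_refl]
        f_the_inv_into_f[OF bij_betw_imp_inj_on[OF assms(1)]] by auto
    then show "\<gamma> t \<in> \<Theta> \<and> the_inv_into S \<theta> (\<gamma> t) \<in> {R \<in> S. T (\<theta> R) - T (\<theta> P) \<in> B}"
      using \<gamma>(4)[OF t] subspace_scale[OF assms(3,4)] by simp
  qed
  then show thesis using that \<gamma>(6) by blast
qed

text \<open>If the tangent spaces are orthogonal, every \<open>b\<close> in \<open>B\<close> is the
  image of a tangent vector orthogonal to \<open>A\<close>, which puts \<open>B\<close> inside the
  dual complement. Conversely, the derivative of the dual map sends tangent vectors of the dual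
  submanifold into \<open>B\<close>.\<close>

lemma orthogonal_autoparallel_iff:
  assumes bij: "bij_betw \<theta> S \<Theta>" and P: "P \<in> S" and A: "subspace A" and B: "subspace B"
    and dim: "dim B = CARD('n) - dim A"
  shows "(\<forall>u \<in> tangent_space \<theta> {R \<in> S. \<theta> R - \<theta> P \<in> A} P.
      \<forall>v \<in> tangent_space \<theta> {R \<in> S. T (\<theta> R) - T (\<theta> P) \<in> B} P.
       inner_at \<theta> (L_divergence \<alpha> \<phi>) P u v = 0) \<longleftrightarrow> B = dual_complement (\<theta> P) A"
    (is "?orth \<longleftrightarrow> _")
proof
  have x: "\<theta> P \<in> \<Theta>" using bij P bij_betwE by blast
  have TA: "u \<in> A" if "u \<in> tangent_space \<theta> {R \<in> S. \<theta> R - \<theta> P \<in> A} P" for u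
    using tangent_space_image_in_subspace[OF A has_derivative_ident that] .
  {
    assume orth: ?orth
    have "B \<subseteq> dual_complement (\<theta> P) A"
    proof
      fix b assume "b \<in> B"
      then obtain v where v: "v \<in> tangent_space \<theta> {R \<in> S. T (\<theta> R) - T (\<theta> P) \<in> B} P"
        "frechet_derivative T (at (\<theta> P)) v = b"
        using tangent_space_dual_surj[OF bij P B] by blast
      have "\<forall>u\<in>A. u \<bullet> neg_metric (\<theta> P) v = 0"
      proof
        fix u assume "u \<in> A"
        then have "u \<in> tangent_space \<theta> {R \<in> S. \<theta> R - \<theta> P \<in> A} P"
          using subspace_subset_tangent_space[OF bij open_\<Theta> P A] by blast
        then have "inner_at \<theta> (L_divergence \<alpha> \<phi>) P u v = 0" using orth v(1) by blast
        then show "u \<bullet> neg_metric (\<theta> P) v = 0" by (simp add: inner_at_L_divergence[where c = \<theta>, OF x])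
      qed
      then show "b \<in> dual_complement (\<theta> P) A"
        using frechet_derivative_in_dual_complement[OF x] v(2) by blast
    qed
    \<comment> \<open>Both subspaces have the same dimension, so the inclusion is an
      equality.\<close>
    then show "B = dual_complement (\<theta> P) A"
      by (intro subspace_dim_equal B subspace_dual_complement)
        (simp_all add: dim dim_dual_complement[OF x A])
  next
    assume eq: "B = dual_complement (\<theta> P) A"
    show ?orth
    proof (intro ballI)
      fix u v assume u: "u \<in> tangent_space \<theta> {R \<in> S. \<theta> R - \<theta> P \<in> A} P"
        and v: "v \<in> tangent_space \<theta> {R \<in> S. T (\<theta> R) - T (\<theta> P) \<in> B} P"
      have "frechet_derivative T (at (\<theta> P)) v \<in> B"
        using smooth_on_imp_has_derivative[OF smooth_dual_map x]
        by (rule tangent_space_image_in_subspace[OF B _ v])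
      then show "inner_at \<theta> (L_divergence \<alpha> \<phi>) P u v = 0"
        using TA[OF u] frechet_derivative_in_dual_complement[OF x] eq
        by (simp add: inner_at_L_divergence[where c = \<theta>, OF x])
    qed
  }
qed

text \<open>At a common point the primal difference lies in \<open>A\<close> and the dual difference
  is the twist of a vector orthogonal to \<open>A\<close>, so
  \<open>eq_of_orthogonal_dual_difference\<close> applies.\<close>

lemma autoparallel_Int_dual_complement:
  assumes bij: "bij_betw \<theta> S \<Theta>" and P: "P \<in> S" and A: "subspace A"
  shows "{R \<in> S. \<theta> R - \<theta> P \<in> A} \<inter> {R \<in> S. T (\<theta> R) - T (\<theta> P) \<in> dual_complement (\<theta> P) A} = {P}"
    (is "?L = _")
proof
  have on: "\<theta> R \<in> \<Theta>" if "R \<in> S" for R using bij that bij_betwE by blast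
  show "?L \<subseteq> {P}"
  proof
    fix R assume R: "R \<in> ?L"
    then obtain b where b: "T (\<theta> R) - T (\<theta> P) = dual_twist (\<theta> P) b" "\<forall>a\<in>A. orthogonal a b"
      unfolding dual_complement_def by blast
    have "(\<theta> R - \<theta> P) \<bullet> b = 0" using b(2) R by (simp add: orthogonal_def)
    then have "\<theta> R = \<theta> P"
      using eq_of_orthogonal_dual_difference[OF on on b(1)] P R by blast
    then show "R \<in> {P}" using bij_betw_imp_inj_on[OF bij] P R by (auto dest: inj_onD)
  qed
  show "{P} \<subseteq> ?L" using P A subspace_dual_complement by (simp add: subspace_0)
qed

end

theorem theorem2:
  fixes \<alpha> :: real
    and \<Theta> :: "(real^'n) set"
    and \<phi> :: "real^'n \<Rightarrow> real"
    and S :: "'p set"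
    and \<theta> \<eta> :: "'p \<Rightarrow> real^'n"
    and k :: nat
    and \<E> :: "'p set"
    and P\<^sub>0 :: 'p
  assumes "\<alpha> > 0"
    and "open \<Theta>" and "convex \<Theta>" and "\<Theta> \<noteq> {}"
    and "smooth_on \<Theta> \<phi>"
    and "concave_on \<Theta> (\<lambda>x. exp (\<alpha> * \<phi> x))"
    and "\<And>x. x \<in> \<Theta> \<Longrightarrow> negative_definite (hessian (\<lambda>x. exp (\<alpha> * \<phi> x)) x)"
    and "\<And>x. x \<in> \<Theta> \<Longrightarrow> 1 - \<alpha> * (grad \<phi> x \<bullet> x) > 0"
    and "bij_betw \<theta> S \<Theta>"
    and "\<And>P. P \<in> S \<Longrightarrow> \<eta> P = dual_map \<alpha> \<phi> (\<theta> P)"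
    and "1 \<le> k" and "k < CARD('n)"
    and "maximal_autoparallel S \<theta> k \<E>"
    and "P\<^sub>0 \<in> \<E>"
  shows "\<exists>!\<M>. maximal_autoparallel S \<eta> (CARD('n) - k) \<M> \<and> \<E> \<inter> \<M> = {P\<^sub>0} \<and>
    (\<forall>u \<in> tangent_space \<theta> \<E> P\<^sub>0. \<forall>v \<in> tangent_space \<theta> \<M> P\<^sub>0.
       inner_at \<theta> (L_divergence \<alpha> \<phi>) P\<^sub>0 u v = 0)"
proof -
  interpret alpha_exp_concave \<alpha> \<Theta> \<phi>
    using assms(1-3,5,7,8) by unfold_locales
  obtain A where A: "subspace A" "dim A = k" "\<E> = {R \<in> S. \<theta> R - \<theta> P\<^sub>0 \<in> A}" and P: "P\<^sub>0 \<in> S"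
    using maximal_autoparallel_basepoint[OF assms(13,14)] by blast
  have x: "\<theta> P\<^sub>0 \<in> \<Theta>" using assms(9) P bij_betwE by blast
  have \<eta>: "{R \<in> S. \<eta> R - \<eta> P\<^sub>0 \<in> B} = {R \<in> S. T (\<theta> R) - T (\<theta> P\<^sub>0) \<in> B}" for B
    using assms(10) P by auto
  let ?B = "dual_complement (\<theta> P\<^sub>0) A"
  let ?M = "{R \<in> S. \<eta> R - \<eta> P\<^sub>0 \<in> ?B}"
  note iff = orthogonal_autoparallel_iff[OF assms(9) P A(1)]
  have dimB: "dim ?B = CARD('n) - dim A" by (rule dim_dual_complement[OF x A(1)])
  show ?thesis
  proof (rule ex1I[of _ ?M], intro conjI)
    show "maximal_autoparallel S \<eta> (CARD('n) - k) ?M"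
      unfolding maximal_autoparallel_def using P subspace_dual_complement dimB A(2) by blast
    show "\<E> \<inter> ?M = {P\<^sub>0}"
      unfolding \<eta> A(3) by (rule autoparallel_Int_dual_complement[OF assms(9) P A(1)])
    show "\<forall>u \<in> tangent_space \<theta> \<E> P\<^sub>0. \<forall>v \<in> tangent_space \<theta> ?M P\<^sub>0.
       inner_at \<theta> (L_divergence \<alpha> \<phi>) P\<^sub>0 u v = 0"
      unfolding \<eta> A(3) iff[OF subspace_dual_complement dimB] ..
  next
    fix M assume M: "maximal_autoparallel S \<eta> (CARD('n) - k) M \<and> \<E> \<inter> M = {P\<^sub>0} \<and>
      (\<forall>u \<in> tangent_space \<theta> \<E> P\<^sub>0. \<forall>v \<in> tangent_space \<theta> M P\<^sub>0.
        inner_at \<theta> (L_divergence \<alpha> \<phi>) P\<^sub>0 u v = 0)"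
    \<comment> \<open>The intersection condition puts \<open>P\<^sub>0\<close> into
      \<open>M\<close>, so \<open>M\<close> can be based at \<open>P\<^sub>0\<close>; orthogonality
      then determines its direction space.\<close>
    then have "P\<^sub>0 \<in> M" by blast
    then obtain B where B: "subspace B" "dim B = CARD('n) - k" "M = {R \<in> S. \<eta> R - \<eta> P\<^sub>0 \<in> B}"
      using maximal_autoparallel_basepoint[OF conjunct1[OF M]] by blast
    have "B = ?B"
      using conjunct2[OF conjunct2[OF M]] unfolding B(3) \<eta> A(3)
      by (rule iff[OF B(1), THEN iffD1, rotated]) (simp add: A(2) B(2))
    then show "M = ?M" using B(3) by simp
  qed
qed

end
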